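(* For all integers $m,n\geq 1$ there exists a globally simple non-zero sum Heffter array $\mathrm{NH}(m,n;n,m)$.
   Context: For $m,n\ge 1$, a non-zero sum Heffter array $\mathrm{NH}(m,n;n,m)$ is an $m\times n$ array $A$ with no empty cells and with entries in $\mathbb{Z}_{2mn+1}$ such that: the multiset $\{\pm x \mid x\in A\}$ (two elements $x,-x$ for each cell with entry $x$) contains each element of $\mathbb{Z}_{2mn+1}\setminus\{0\}$ exactly once; and the sum of the elements in every row and in every column is different from $0$ in $\mathbb{Z}_{2mn+1}$. For a finite subset $T$ of an abelian group, an ordering $(t_1,\dots,t_k)$ of the elements of $T$ is simple if no proper nonempty subsequence of consecutive terms sums to $0$. When the total sum $t_1+\cdots+t_k$ is non-zero, this is equivalent to $0,s_1,\dots,s_k$ being pairwise distinct, where $s_i=\sum_{j=1}^i t_j$. The natural ordering of a row (resp. column) of $A$ is the ordering of its entries from left to right (resp. from top to bottom). The array $A$ is globally simple if the natural ordering of each row and of each column is simple. *)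

theory Defs
  imports Complex_Main "HOL-Library.Multiset" "HOL-Library.Sublist" "HOL-Number_Theory.Cong"
begin

text \<open>An element of the cyclic group of order \<open>v\<close> is represented by its canonical
  representative in \<open>{0..<v}\<close>; sums are taken in the integers and compared modulo \<open>v\<close>.
  An \<open>m \<times> n\<close> array is a function \<open>A\<close> of which only the values \<open>A i j\<close>
  with \<open>i < m\<close> and \<open>j < n\<close> are relevant (indices start at 0).\<close>

text \<open>Library \<open>strict_sublist\<close> is the relation of being a block of consecutive terms
  different from the whole list.  The first two conjuncts say that the list is an ordering of
  a set of elements of the group.\<close>

definition simple_ordering :: "int \<Rightarrow> int list \<Rightarrow> bool" where
  "simple_ordering v ts \<longleftrightarrow>
     set ts \<subseteq> {0..<v} \<and> distinct ts \<and>
     (\<forall>us. us \<noteq> [] \<and> strict_sublist us ts \<longrightarrow> \<not> [sum_list us = 0] (mod v))"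

definition heffter_modulus :: "nat \<Rightarrow> nat \<Rightarrow> int" where
  "heffter_modulus m n = 2 * int m * int n + 1"

definition array_cells :: "nat \<Rightarrow> nat \<Rightarrow> (nat \<times> nat) set" where
  "array_cells m n = {..<m} \<times> {..<n}"

definition array_row :: "nat \<Rightarrow> (nat \<Rightarrow> nat \<Rightarrow> int) \<Rightarrow> nat \<Rightarrow> int list" where
  "array_row n A i = map (\<lambda>j. A i j) [0..<n]"

definition array_col :: "nat \<Rightarrow> (nat \<Rightarrow> nat \<Rightarrow> int) \<Rightarrow> nat \<Rightarrow> int list" where
  "array_col m A j = map (\<lambda>i. A i j) [0..<m]"

definition signed_entries :: "nat \<Rightarrow> nat \<Rightarrow> (nat \<Rightarrow> nat \<Rightarrow> int) \<Rightarrow> int multiset" where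
  "signed_entries m n A =
     {# A i j mod heffter_modulus m n. (i, j) \<in># mset_set (array_cells m n) #} +
     {# (- A i j) mod heffter_modulus m n. (i, j) \<in># mset_set (array_cells m n) #}"

definition nonzero_sum_heffter :: "nat \<Rightarrow> nat \<Rightarrow> (nat \<Rightarrow> nat \<Rightarrow> int) \<Rightarrow> bool" where
  "nonzero_sum_heffter m n A \<longleftrightarrow>
     (\<forall>i<m. \<forall>j<n. A i j \<in> {0..<heffter_modulus m n}) \<and>
     (\<forall>x \<in> {0..<heffter_modulus m n} - {0}. count (signed_entries m n A) x = 1) \<and>
     (\<forall>i<m. \<not> [sum_list (array_row n A i) = 0] (mod heffter_modulus m n)) \<and>
     (\<forall>j<n. \<not> [sum_list (array_col m A j) = 0] (mod heffter_modulus m n))"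

definition globally_simple :: "nat \<Rightarrow> nat \<Rightarrow> (nat \<Rightarrow> nat \<Rightarrow> int) \<Rightarrow> bool" where
  "globally_simple m n A \<longleftrightarrow>
     (\<forall>i<m. simple_ordering (heffter_modulus m n) (array_row n A i)) \<and>
     (\<forall>j<n. simple_ordering (heffter_modulus m n) (array_col m A j))"

end

theory Submission
  imports Defs
begin

text \<open>Take the array with \<open>A i j = (-1)\<^sup>i\<^sup>+\<^sup>j (i n + j + 1)\<close>. Along every row and every column the
  signs alternate and the absolute values strictly increase, so, as in Leibniz's criterion, a sum
  of consecutive entries has the sign of its last term and does not exceed it in absolute value.
  Thus it lies strictly between \<open>-v/2\<close> and \<open>v/2\<close> and is non-zero, hence non-zero modulo \<open>v\<close>.\<close>

lemma cong_imp_eq_int: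
  fixes x y v :: int
  assumes "[x = y] (mod v)" and "\<bar>x - y\<bar> < v"
  shows "x = y"
proof (rule ccontr)
  assume "x \<noteq> y"
  then have "\<bar>v\<bar> \<le> \<bar>x - y\<bar>"
    using assms(1) by (intro dvd_imp_le_int) (simp_all add: cong_iff_dvd_diff)
  then show False using assms(2) by linarith
qed

lemma cong_sum_list_map_mod:
  fixes f :: "'a \<Rightarrow> int"
  shows "[(\<Sum>x\<leftarrow>xs. f x mod v) = (\<Sum>x\<leftarrow>xs. f x)] (mod v)"
  by (induction xs) (auto intro: cong_add)

lemma alternating_sum_bounds:
  fixes f :: "nat \<Rightarrow> int"
  assumes "strict_mono f" and "f p > 0" and "p \<le> q"
  shows "(-1) ^ q * (\<Sum>k\<leftarrow>[p..<Suc q]. (-1) ^ k * f k) \<in> {0<..f q}"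
  using \<open>p \<le> q\<close>
proof (induction q rule: dec_induct)
  case base
  then show ?case using assms(2) by (simp flip: power_add mult.assoc)
next
  case (step q)
  let ?S = "\<Sum>k\<leftarrow>[p..<Suc q]. (-1) ^ k * f k"
  have "(\<Sum>k\<leftarrow>[p..<Suc (Suc q)]. (-1) ^ k * f k) = ?S + (-1) ^ Suc q * f (Suc q)"
    using step.hyps by simp
  then have "(-1) ^ Suc q * (\<Sum>k\<leftarrow>[p..<Suc (Suc q)]. (-1) ^ k * f k)
      = f (Suc q) - (-1) ^ q * ?S"
    by (simp only: distrib_left) (simp flip: power_add mult.assoc)
  moreover have "f q < f (Suc q)"
    using assms(1) by (simp add: strict_mono_Suc_iff)
  ultimately show ?case using step.IH by simp
qed

lemma sublist_map_upt:
  assumes "sublist us (map g [0..<n])" and "us \<noteq> []"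
  obtains p q where "p \<le> q" and "q < n" and "us = map g [p..<Suc q]"
proof -
  obtain ps ss where eq: "map g [0..<n] = ps @ us @ ss"
    using assms(1) by (auto simp: sublist_def)
  have len: "n = length ps + length us + length ss"
    using arg_cong[OF eq, of length] by simp
  have "us = take (length us) (drop (length ps) (map g [0..<n]))"
    by (simp add: eq)
  also have "\<dots> = map g [length ps..<length ps + length us]"
    using len by (simp add: drop_map take_map)
  finally show thesis
    using that[of "length ps" "length ps + length us - 1"] len assms(2)
    by (cases us) auto
qed

lemma alternating_block_nonzero:
  fixes f :: "nat \<Rightarrow> int"
  assumes "strict_mono f" and "f 0 > 0" and "p \<le> q" and "2 * f q < v" and "\<bar>e\<bar> = 1"
  shows "\<not> [(\<Sum>k\<leftarrow>[p..<Suc q]. (e * (-1) ^ k * f k) mod v) = 0] (mod v)"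
proof
  let ?S = "\<Sum>k\<leftarrow>[p..<Suc q]. (-1) ^ k * f k"
  assume "[(\<Sum>k\<leftarrow>[p..<Suc q]. (e * (-1) ^ k * f k) mod v) = 0] (mod v)"
  then have "[(\<Sum>k\<leftarrow>[p..<Suc q]. e * (-1) ^ k * f k) = 0] (mod v)"
    by (rule cong_trans[OF cong_sym[OF cong_sum_list_map_mod]])
  then have "[e * ?S = 0] (mod v)"
    by (simp only: mult.assoc sum_list_const_mult)
  moreover have "f p > 0"
    using assms(1,2) strict_mono_less_eq[of f 0 p] by simp
  then have "(-1) ^ q * ?S \<in> {0<..f q}"
    using alternating_sum_bounds assms(1,3) by blast
  then have "0 < \<bar>(-1) ^ q * ?S\<bar>" "\<bar>(-1) ^ q * ?S\<bar> \<le> f q" by auto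
  then have "0 < \<bar>e * ?S\<bar>" "\<bar>e * ?S\<bar> \<le> f q"
    using assms(5) by (simp_all only: abs_mult power_abs) simp_all
  ultimately show False
    using cong_imp_eq_int[of "e * ?S" 0 v] assms(4) by linarith
qed

lemma signed_mod_eqD:
  fixes x y v :: int
  assumes "(e * x) mod v = (e' * y) mod v" and "\<bar>e\<bar> = 1" and "\<bar>e'\<bar> = 1"
    and "0 < x" and "0 < y" and "2 * x < v" and "2 * y < v"
  shows "x = y" and "e = e'"
proof -
  have "e = 1 \<or> e = -1" "e' = 1 \<or> e' = -1" using assms(2,3) by auto
  moreover from this have "e * x = e' * y"
    using assms by (intro cong_imp_eq_int[of _ _ v]) (auto simp: cong_def)
  ultimately show "x = y" "e = e'"
    using assms(4,5) by auto
qed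

lemma simple_ordering_alternating:
  fixes f :: "nat \<Rightarrow> int"
  assumes "strict_mono f" and "f 0 > 0" and "\<And>k. k < n \<Longrightarrow> 2 * f k < v" and "\<bar>e\<bar> = 1" and "v > 0"
  shows "simple_ordering v (map (\<lambda>k. (e * (-1) ^ k * f k) mod v) [0..<n])"
    (is "simple_ordering v (map ?g _)")
  unfolding simple_ordering_def
proof (intro conjI allI impI)
  show "set (map ?g [0..<n]) \<subseteq> {0..<v}" using assms(5) by auto
  have pos: "f k > 0" for k
    using assms(1,2) strict_mono_less_eq[of f 0 k] by simp
  have "inj_on ?g {0..<n}"
  proof (rule inj_onI)
    fix k l assume "k \<in> {0..<n}" "l \<in> {0..<n}" and "?g k = ?g l"
    then have "f k = f l"
      using signed_mod_eqD(1)[of "e * (-1) ^ k" "f k" v "e * (-1) ^ l" "f l"] assms(3,4) pos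
      by (auto simp: abs_mult)
    then show "k = l" using assms(1) by (simp add: strict_mono_eq)
  qed
  then show "distinct (map ?g [0..<n])" by (simp add: distinct_map)
  fix us assume "us \<noteq> [] \<and> strict_sublist us (map ?g [0..<n])"
  then have "sublist us (map ?g [0..<n])" "us \<noteq> []"
    by (simp_all add: sublist_order.less_imp_le)
  then obtain p q where "p \<le> q" "q < n" "us = map ?g [p..<Suc q]"
    by (rule sublist_map_upt)
  then show "\<not> [sum_list us = 0] (mod v)"
    using alternating_block_nonzero[of f p q v e] assms(1-4) by simp
qed

lemma alternating_total_nonzero:
  fixes f :: "nat \<Rightarrow> int"
  assumes "strict_mono f" and "f 0 > 0" and "\<And>k. k < n \<Longrightarrow> 2 * f k < v" and "\<bar>e\<bar> = 1" and "n \<ge> 1"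
  shows "\<not> [sum_list (map (\<lambda>k. (e * (-1) ^ k * f k) mod v) [0..<n]) = 0] (mod v)"
  using alternating_block_nonzero[of f 0 "n - 1" v e] assms by simp

theorem theorem5p5:
  fixes m n :: nat
  assumes "m \<ge> 1" and "n \<ge> 1"
  shows "\<exists>A :: nat \<Rightarrow> nat \<Rightarrow> int. nonzero_sum_heffter m n A \<and> globally_simple m n A"
proof -
  define v where "v = heffter_modulus m n"
  define b where "b = (\<lambda>i j. int (i * n + j + 1))"
  define A where "A = (\<lambda>i j. ((-1) ^ i * (-1) ^ j * b i j) mod v)"
  have v: "v = 2 * int (m * n) + 1" and v_pos: "v > 0"
    by (simp_all add: v_def heffter_modulus_def add_nonneg_pos)
  have b_pos: "b i j > 0" for i j
    by (simp only: b_def of_nat_0_less_iff)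
  have b_less: "2 * b i j < v" if "i < m" "j < n" for i j
  proof -
    have "i * n + j + 1 \<le> Suc i * n" using that(2) by simp
    also have "\<dots> \<le> m * n" using that(1) by (intro mult_le_mono1) simp
    finally have "b i j \<le> int (m * n)" by (simp only: b_def of_nat_le_iff)
    then show ?thesis unfolding v by linarith
  qed
  have row: "array_row n A i = map (\<lambda>j. ((-1) ^ i * (-1) ^ j * b i j) mod v) [0..<n]" for i
    by (simp add: array_row_def A_def)
  have col: "array_col m A j = map (\<lambda>i. ((-1) ^ j * (-1) ^ i * b i j) mod v) [0..<m]" for j
    by (simp add: array_col_def A_def mult.commute)
  have mono_row: "strict_mono (b i)" for i
    by (auto simp: strict_mono_def b_def)
  have mono_col: "strict_mono (\<lambda>i. b i j)" for j
    using assms(2) by (auto simp: strict_mono_def b_def)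

  define C where "C = array_cells m n"
  define h where "h = (\<lambda>e (i, j). (e * (-1) ^ (i + j) * b i j) mod v)"
  have b_inj: "(i, j) = (i', j')" if "b i j = b i' j'" "j < n" "j' < n" for i j i' j'
  proof -
    have eq: "i * n + j = i' * n + j'"
      using that(1) by (simp only: b_def of_nat_eq_iff add_right_cancel)
    have "i = i'" using arg_cong[OF eq, of "\<lambda>x. x div n"] that(2,3) by simp
    then show ?thesis using eq by simp
  qed
  have mod_nonzero: "(e * b i j) mod v \<in> {1..<v}" if "i < m" "j < n" "\<bar>e\<bar> = 1" for e i j
  proof -
    have "(e * b i j) mod v \<noteq> 0"
      using cong_imp_eq_int[of "e * b i j" 0 v] b_pos[of i j] b_less[OF that(1,2)] that(3)
      by (auto simp: cong_def abs_mult)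
    moreover have "0 \<le> (e * b i j) mod v" "(e * b i j) mod v < v"
      using v_pos by simp_all
    ultimately show ?thesis by simp
  qed
  have h_eqD: "c = c' \<and> e = e'"
    if "c \<in> C" "c' \<in> C" "h e c = h e' c'" "\<bar>e\<bar> = 1" "\<bar>e'\<bar> = 1" for c c' e e'
  proof -
    obtain i j i' j' where c: "c = (i, j)" "c' = (i', j')" by fastforce
    with that have ij: "i < m" "j < n" "i' < m" "j' < n"
      by (simp_all add: C_def array_cells_def)
    have eq: "(e * (-1) ^ (i + j) * b i j) mod v = (e' * (-1) ^ (i' + j') * b i' j') mod v"
      using that(3) by (simp add: h_def c)
    have "b i j = b i' j'" and "e * (-1) ^ (i + j) = e' * (-1) ^ (i' + j')"
      using signed_mod_eqD[OF eq _ _ b_pos b_pos b_less b_less] ij that(4,5)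
      by (simp_all add: abs_mult)
    moreover from this(1) have "c = c'" using b_inj c ij by simp
    ultimately show ?thesis using c by simp
  qed
  have finC: "finite C" and cardC: "card C = m * n"
    by (simp_all add: C_def array_cells_def)
  have inj: "inj_on (h e) C" if "\<bar>e\<bar> = 1" for e
    using h_eqD that by (intro inj_onI) blast
  have disj: "h 1 ` C \<inter> h (-1) ` C = {}"
    using h_eqD[of _ _ 1 "-1"] by fastforce
  have "h e ` C \<subseteq> {1..<v}" if "\<bar>e\<bar> = 1" for e
    using mod_nonzero that by (fastforce simp: C_def array_cells_def h_def abs_mult)
  then have un: "h 1 ` C \<union> h (-1) ` C = {1..<v}"
    using disj finC cardC inj
    by (intro card_subset_eq)
      (simp_all add: card_Un_disjoint card_image v nat_mult_distrib nat_add_distrib)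
  have "signed_entries m n A = image_mset (h 1) (mset_set C) + image_mset (h (-1)) (mset_set C)"
    by (simp add: signed_entries_def A_def h_def C_def power_add mod_minus_eq case_prod_unfold
        flip: v_def)
  also have "\<dots> = mset_set {1..<v}"
    using finC inj disj mset_set_Union[of "h 1 ` C" "h (-1) ` C"]
    by (simp add: image_mset_mset_set un)
  finally have "\<forall>x\<in>{0..<v} - {0}. count (signed_entries m n A) x = 1"
    by simp
  moreover have "A i j \<in> {0..<v}" for i j
    using v_pos by (simp add: A_def)
  moreover have "\<not> [sum_list (array_row n A i) = 0] (mod v)"
      "simple_ordering v (array_row n A i)" if "i < m" for i
    unfolding row using mono_row b_pos b_less[OF that] assms(2) v_pos
    by (intro alternating_total_nonzero simple_ordering_alternating; simp add: power_abs)+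
  moreover have "\<not> [sum_list (array_col m A j) = 0] (mod v)"
      "simple_ordering v (array_col m A j)" if "j < n" for j
    unfolding col using mono_col b_pos b_less[OF _ that] assms(1) v_pos
    by (intro alternating_total_nonzero[of "\<lambda>i. b i j"]
        simple_ordering_alternating[of "\<lambda>i. b i j"]; simp add: power_abs)+
  ultimately show ?thesis
    unfolding nonzero_sum_heffter_def globally_simple_def v_def[symmetric] by blast
qed

end
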